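(* Let $p\in[1,\infty]$ and let $L(\mathbb{R})$ be the set of Lebesgue integrable real functions on $\mathbb{R}$, with functions equal almost everywhere identified. Define the metrics $$d^p(f,g)=\Big(\big(\int (f-g)^+\,dx\big)^p+\big(\int (f-g)^-\,dx\big)^p\Big)^{1/p},\qquad d_N^p(f,g)=\frac{d^p(f,g)}{\int\max(|f|,|g|,|f-g|)\,dx}$$ on $L(\mathbb{R})$ (for $p=\infty$, $d^\infty(f,g)$ is the maximum of the two integrals; $0/0:=0$ in $d_N^p$). Then $(L(\mathbb{R}),d^p)$ and $(L(\mathbb{R}),d_N^p)$ are complete metric spaces.
   Context: For a real function $f$, $f^+=\max(f,0)$ and $f^-=\max(-f,0)$. Integrals are over $\mathbb{R}$ with respect to Lebesgue measure. A metric space is complete if every Cauchy sequence converges in it. *)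

theory Defs
  imports "HOL-Analysis.Analysis"
begin

definition pos_part :: "('a \<Rightarrow> real) \<Rightarrow> 'a \<Rightarrow> real"
  where "pos_part f x = max (f x) 0"

definition neg_part :: "('a \<Rightarrow> real) \<Rightarrow> 'a \<Rightarrow> real"
  where "neg_part f x = max (- f x) 0"

text \<open>The \<open>\<ell>\<^sup>p\<close> norm of a pair of nonnegative reals, for \<open>p \<in> [1, \<infinity>]\<close>.\<close>

definition lp_pair :: "ereal \<Rightarrow> real \<Rightarrow> real \<Rightarrow> real"
  where "lp_pair p a b =
    (if p = \<infinity> then max a b
     else (a powr real_of_ereal p + b powr real_of_ereal p) powr (1 / real_of_ereal p))"

definition dp_fun :: "ereal \<Rightarrow> (real \<Rightarrow> real) \<Rightarrow> (real \<Rightarrow> real) \<Rightarrow> real"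
  where "dp_fun p f g =
    lp_pair p (LINT x|lebesgue. pos_part (\<lambda>y. f y - g y) x)
              (LINT x|lebesgue. neg_part (\<lambda>y. f y - g y) x)"

text \<open>The convention \<open>0/0 = 0\<close> is built into division. A zero denominator only arises when
  \<open>f\<close> and \<open>g\<close> vanish almost everywhere, in which case the numerator is zero as well.\<close>

definition dpN_fun :: "ereal \<Rightarrow> (real \<Rightarrow> real) \<Rightarrow> (real \<Rightarrow> real) \<Rightarrow> real"
  where "dpN_fun p f g =
    dp_fun p f g / (LINT x|lebesgue. Max {\<bar>f x\<bar>, \<bar>g x\<bar>, \<bar>f x - g x\<bar>})"

definition L1_eq :: "(real \<Rightarrow> real) \<Rightarrow> (real \<Rightarrow> real) \<Rightarrow> bool"
  where "L1_eq f g \<longleftrightarrow>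
    integrable lebesgue f \<and> integrable lebesgue g \<and> (AE x in lebesgue. f x = g x)"

lemma part_equivp_L1_eq: "part_equivp L1_eq"
proof (rule part_equivpI)
  show "\<exists>f. L1_eq f f"
    by (rule exI[of _ "\<lambda>_. 0"]) (simp add: L1_eq_def)
  show "symp L1_eq"
    by (auto simp: symp_def L1_eq_def elim: eventually_mono)
  show "transp L1_eq"
    unfolding transp_def L1_eq_def by (auto elim: eventually_elim2)
qed

text \<open>The elements of this type are exactly the almost-everywhere classes of Lebesgue
  integrable functions, since the relation is reflexive only on integrable functions.\<close>

quotient_type L1 = "real \<Rightarrow> real" / partial: L1_eq
  by (rule part_equivp_L1_eq)

lemma dp_fun_cong:
  assumes "L1_eq f f'" "L1_eq g g'"
  shows "dp_fun p f g = dp_fun p f' g'"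
proof -
  note [measurable] = assms[unfolded L1_eq_def, THEN conjunct1, THEN borel_measurable_integrable]
    assms[unfolded L1_eq_def, THEN conjunct2, THEN conjunct1, THEN borel_measurable_integrable]
  have ae: "AE x in lebesgue. f x = f' x" "AE x in lebesgue. g x = g' x"
    using assms by (auto simp: L1_eq_def)
  have "(LINT x|lebesgue. pos_part (\<lambda>y. f y - g y) x)
      = (LINT x|lebesgue. pos_part (\<lambda>y. f' y - g' y) x)"
    unfolding pos_part_def
    by (rule integral_cong_AE; (measurable)?) (use ae in eventually_elim, simp)
  moreover have "(LINT x|lebesgue. neg_part (\<lambda>y. f y - g y) x)
      = (LINT x|lebesgue. neg_part (\<lambda>y. f' y - g' y) x)"
    unfolding neg_part_def
    by (rule integral_cong_AE; (measurable)?) (use ae in eventually_elim, simp)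
  ultimately show ?thesis
    by (simp add: dp_fun_def)
qed

lemma dpN_fun_cong:
  assumes "L1_eq f f'" "L1_eq g g'"
  shows "dpN_fun p f g = dpN_fun p f' g'"
proof -
  note [measurable] = assms[unfolded L1_eq_def, THEN conjunct1, THEN borel_measurable_integrable]
    assms[unfolded L1_eq_def, THEN conjunct2, THEN conjunct1, THEN borel_measurable_integrable]
  have ae: "AE x in lebesgue. f x = f' x" "AE x in lebesgue. g x = g' x"
    using assms by (auto simp: L1_eq_def)
  have "(LINT x|lebesgue. Max {\<bar>f x\<bar>, \<bar>g x\<bar>, \<bar>f x - g x\<bar>})
      = (LINT x|lebesgue. Max {\<bar>f' x\<bar>, \<bar>g' x\<bar>, \<bar>f' x - g' x\<bar>})"
    by (rule integral_cong_AE; (simp, measurable)?) (use ae in eventually_elim, simp)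
  then show ?thesis
    using dp_fun_cong[OF assms] by (simp add: dpN_fun_def)
qed

lift_definition dp :: "ereal \<Rightarrow> L1 \<Rightarrow> L1 \<Rightarrow> real" is dp_fun
  by (rule dp_fun_cong)

lift_definition dpN :: "ereal \<Rightarrow> L1 \<Rightarrow> L1 \<Rightarrow> real" is dpN_fun
  by (rule dpN_fun_cong)

end

theory Submission
  imports Defs
begin

text \<open>The distance \<open>d\<^sup>p\<close> is the \<open>\<ell>\<^sup>p\<close> norm of the pair of excesses \<open>\<integral>(f - g)\<^sup>+\<close>, \<open>\<integral>(g - f)\<^sup>+\<close>.
  Each excess satisfies the triangle inequality, so \<open>d\<^sup>p\<close> is a metric by Minkowski's inequality,
  and it is equivalent to the \<open>L\<^sup>1\<close> distance, which is complete. The denominator of \<open>d\<^sub>N\<close>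
  equals \<open>(\<parallel>f\<parallel> + \<parallel>g\<parallel> + \<parallel>f - g\<parallel>) / 2\<close>, so that \<open>d\<^sub>N\<close> is a variant of the Steinhaus transform of
  the \<open>L\<^sup>1\<close> distance.\<close>

section \<open>Minkowski's inequality and bounds for the norm of a pair\<close>

text \<open>For positive \<open>x\<close> and \<open>y\<close> this is convexity of the power
  function. If one of them is 0, its power is 0 too, and the claim reduces to
  \<open>w powr r \<le> w\<close> for \<open>w\<close> in [0, 1].\<close>

lemma powr_convex_nonneg:
  fixes x y u v r :: real
  assumes "1 \<le> r" "0 \<le> x" "0 \<le> y" "0 \<le> u" "0 \<le> v" "u + v = 1"
  shows "(u * x + v * y) powr r \<le> u * x powr r + v * y powr r"
proof -
  have scale: "(w * z) powr r \<le> w * z powr r" if "0 \<le> w" "w \<le> 1" for w z :: real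
  proof -
    have "w powr r \<le> w"
      using that powr_mono'[of 1 r w] assms(1) by (cases "w = 0") auto
    then show ?thesis
      by (simp add: powr_mult mult_right_mono)
  qed
  show ?thesis
  proof (cases "x = 0 \<or> y = 0")
    case True
    then show ?thesis
      using scale[of u x] scale[of v y] assms by auto
  next
    case False
    then show ?thesis
      using convex_onD[OF powr_convex[OF assms(1)], of v x y] assms
      by (simp add: eq_diff_eq[symmetric])
  qed
qed

lemma lp_pair_cases:
  fixes p :: ereal
  assumes "1 \<le> p"
  obtains "p = \<infinity>" | r where "1 \<le> r" "p = ereal r"
  using assms by (cases p) auto

lemma lp_pair_nonneg: "0 \<le> a \<Longrightarrow> 0 \<le> lp_pair p a b"
  by (auto simp: lp_pair_def max_def)

lemma lp_pair_commute: "lp_pair p a b = lp_pair p b a"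
  by (simp add: lp_pair_def add.commute max.commute)

lemma lp_pair_mono:
  assumes "1 \<le> p" "0 \<le> a" "0 \<le> b" "a \<le> c" "b \<le> d"
  shows "lp_pair p a b \<le> lp_pair p c d"
  using assms(1)
proof (cases rule: lp_pair_cases)
  case 1
  then show ?thesis using assms by (auto simp: lp_pair_def)
next
  case (2 r)
  then show ?thesis
    using assms by (auto simp: lp_pair_def intro!: powr_mono2 add_mono)
qed

lemma lp_pair_scale:
  assumes "1 \<le> p" "0 \<le> k"
  shows "lp_pair p (k * a) (k * b) = k * lp_pair p a b"
  using assms(1)
proof (cases rule: lp_pair_cases)
  case 1
  then show ?thesis using assms(2) by (auto simp: lp_pair_def max_mult_distrib_left)
next
  case (2 r)
  have "(k powr r * (a powr r + b powr r)) powr (1 / r) = k * (a powr r + b powr r) powr (1 / r)"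
    using assms(2) 2 by (simp add: powr_mult powr_powr)
  then show ?thesis
    using 2 by (simp add: lp_pair_def powr_mult distrib_left)
qed

lemma lp_pair_zero_right:
  assumes "1 \<le> p" "0 \<le> a"
  shows "lp_pair p a 0 = a"
  using assms(1)
  by (cases rule: lp_pair_cases) (use assms(2) in \<open>auto simp: lp_pair_def powr_powr\<close>)

lemma lp_pair_ge_max:
  assumes "1 \<le> p" "0 \<le> a" "0 \<le> b"
  shows "max a b \<le> lp_pair p a b"
  using lp_pair_mono[of p a 0 a b] lp_pair_mono[of p b 0 b a] assms
  by (simp add: lp_pair_zero_right lp_pair_commute[of p b a])

lemma lp_pair_eq_0_iff:
  assumes "1 \<le> p" "0 \<le> a" "0 \<le> b"
  shows "lp_pair p a b = 0 \<longleftrightarrow> a = 0 \<and> b = 0"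
  using lp_pair_ge_max[OF assms] lp_pair_zero_right[of p 0] assms by auto

text \<open>By homogeneity: for finite \<open>p\<close>, dividing each pair by its norm gives unit
  vectors, and the sum divided by \<open>A + B\<close> is their convex combination with weights
  proportional to the norms. Convexity of the power, coordinate by coordinate, keeps it in the unit
  ball.\<close>

lemma lp_pair_add:
  assumes "1 \<le> p" "0 \<le> a" "0 \<le> b" "0 \<le> c" "0 \<le> d"
  shows "lp_pair p (a + c) (b + d) \<le> lp_pair p a b + lp_pair p c d"
  using assms(1)
proof (cases rule: lp_pair_cases)
  case 1
  then show ?thesis by (auto simp: lp_pair_def)
next
  case (2 r)
  define A where "A = lp_pair p a b"
  define B where "B = lp_pair p c d"
  have nonneg: "0 \<le> A" "0 \<le> B"
    using assms by (auto simp: A_def B_def lp_pair_nonneg)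
  show ?thesis
  proof (cases "A = 0 \<or> B = 0")
    case True
    then show ?thesis
      using assms lp_pair_eq_0_iff[of p a b] lp_pair_eq_0_iff[of p c d]
      by (auto simp: A_def B_def)
  next
    case False
    then have pos: "0 < A" "0 < B" using nonneg by auto
    have powr_sum: "x powr r + y powr r = lp_pair p x y powr r" for x y
      using 2 by (simp add: lp_pair_def powr_powr)
    have unit: "(a / A) powr r + (b / A) powr r = 1" "(c / B) powr r + (d / B) powr r = 1"
      using pos lp_pair_scale[OF assms(1), of "1 / A" a b] lp_pair_scale[OF assms(1), of "1 / B" c d]
      by (auto simp: powr_sum A_def[symmetric] B_def[symmetric])
    define u where "u = A / (A + B)"
    define v where "v = B / (A + B)"
    have uv: "0 \<le> u" "0 \<le> v" "u + v = 1"
      using pos by (auto simp: u_def v_def add_divide_distrib[symmetric])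
    have split: "(x + y) / (A + B) = u * (x / A) + v * (y / B)" for x y
      using pos by (simp add: u_def v_def add_divide_distrib)
    have "((a + c) / (A + B)) powr r + ((b + d) / (A + B)) powr r
        \<le> (u * (a / A) powr r + v * (c / B) powr r) + (u * (b / A) powr r + v * (d / B) powr r)"
      unfolding split using 2 assms uv pos
      by (intro add_mono powr_convex_nonneg) auto
    also have "\<dots> = u * ((a / A) powr r + (b / A) powr r) + v * ((c / B) powr r + (d / B) powr r)"
      by (simp add: algebra_simps)
    also have "\<dots> = 1"
      using unit uv by simp
    finally have "lp_pair p ((a + c) / (A + B)) ((b + d) / (A + B)) \<le> 1"
      using 2 powr_mono2[of "1 / r" _ 1] by (simp add: lp_pair_def)
    then have "lp_pair p (a + c) (b + d) / (A + B) \<le> 1"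
      using pos lp_pair_scale[OF assms(1), of "1 / (A + B)" "a + c" "b + d"] by simp
    then show ?thesis
      using pos by (simp add: A_def[symmetric] B_def[symmetric])
  qed
qed

text \<open>Minkowski's inequality for the splitting of \<open>(a, b)\<close> into
  \<open>(a, 0)\<close> and \<open>(0, b)\<close>.\<close>

lemma lp_pair_le_sum:
  assumes "1 \<le> p" "0 \<le> a" "0 \<le> b"
  shows "lp_pair p a b \<le> a + b"
  using lp_pair_add[of p a 0 0 b] assms
  by (simp add: lp_pair_zero_right lp_pair_commute[of p 0 b])

text \<open>With \<open>N = lp_pair p a b \<ge> max a b\<close>, the pair \<open>(a + t, b + t)\<close> dominates
  \<open>(1 + t / N)\<close> times \<open>(a, b)\<close>.\<close>
lemma lp_pair_diagonal:
  assumes "1 \<le> p" "0 \<le> a" "0 \<le> b" "0 \<le> t"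
  shows "lp_pair p a b + t \<le> lp_pair p (a + t) (b + t)"
proof (cases "lp_pair p a b = 0")
  case True
  then have "a = 0" "b = 0"
    using assms by (simp_all add: lp_pair_eq_0_iff)
  then show ?thesis
    using True assms lp_pair_ge_max[of p t t] by simp
next
  case False
  define N where "N = lp_pair p a b"
  have N: "0 < N" "a \<le> N" "b \<le> N"
    using False assms lp_pair_nonneg[of a p b] lp_pair_ge_max[of p a b] by (auto simp: N_def)
  have dominated: "(1 + t / N) * x \<le> x + t" if "0 \<le> x" "x \<le> N" for x
    using N that assms(4) mult_left_mono[of x N t] by (simp add: field_simps)
  have "lp_pair p a b + t = (1 + t / N) * lp_pair p a b"
    using N by (simp add: N_def[symmetric] field_simps)
  also have "\<dots> = lp_pair p ((1 + t / N) * a) ((1 + t / N) * b)"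
    using N assms by (simp add: lp_pair_scale)
  also have "\<dots> \<le> lp_pair p (a + t) (b + t)"
    using N assms by (intro lp_pair_mono dominated) auto
  finally show ?thesis .
qed

section \<open>The \<open>L\<^sup>1\<close> distance, its two excesses, and its completeness\<close>

definition l1_norm :: "(real \<Rightarrow> real) \<Rightarrow> real"
  where "l1_norm f = (LINT x|lebesgue. \<bar>f x\<bar>)"

definition l1_dist :: "(real \<Rightarrow> real) \<Rightarrow> (real \<Rightarrow> real) \<Rightarrow> real"
  where "l1_dist f g = l1_norm (\<lambda>x. f x - g x)"

definition excess :: "(real \<Rightarrow> real) \<Rightarrow> (real \<Rightarrow> real) \<Rightarrow> real"
  where "excess f g = (LINT x|lebesgue. max (f x - g x) 0)"

lemma dp_fun_eq: "dp_fun p f g = lp_pair p (excess f g) (excess g f)"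
  by (simp add: dp_fun_def excess_def pos_part_def neg_part_def)

lemma excess_nonneg: "0 \<le> excess f g"
  by (simp add: excess_def)

lemma l1_norm_nonneg: "0 \<le> l1_norm f"
  by (simp add: l1_norm_def)

lemma l1_dist_nonneg: "0 \<le> l1_dist f g"
  by (simp add: l1_dist_def l1_norm_nonneg)

lemma l1_dist_commute: "l1_dist f g = l1_dist g f"
  by (simp add: l1_dist_def l1_norm_def abs_minus_commute)

lemma l1_dist_eq_excess:
  assumes "integrable lebesgue f" "integrable lebesgue g"
  shows "l1_dist f g = excess f g + excess g f"
proof -
  have "l1_dist f g = (LINT x|lebesgue. max (f x - g x) 0 + max (g x - f x) 0)"
    unfolding l1_dist_def l1_norm_def by (intro Bochner_Integration.integral_cong) auto
  also have "\<dots> = excess f g + excess g f"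
    unfolding excess_def using assms by (intro Bochner_Integration.integral_add) auto
  finally show ?thesis .
qed

lemma excess_triangle:
  assumes "integrable lebesgue f" "integrable lebesgue g" "integrable lebesgue h"
  shows "excess f h \<le> excess f g + excess g h"
proof -
  have "excess f h \<le> (LINT x|lebesgue. max (f x - g x) 0 + max (g x - h x) 0)"
    unfolding excess_def using assms by (intro integral_mono) auto
  also have "\<dots> = excess f g + excess g h"
    unfolding excess_def using assms by (intro Bochner_Integration.integral_add) auto
  finally show ?thesis .
qed

text \<open>The right-hand side telescopes along \<open>f\<close>, \<open>g\<close>,
  \<open>h\<close>. Hence a detour through \<open>g\<close> has the same slack in both directions of
  the excess, which the triangle inequality for \<open>dpN_fun\<close> relies on.\<close>

lemma excess_diff:
  assumes "integrable lebesgue f" "integrable lebesgue g"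
  shows "excess f g - excess g f = integral\<^sup>L lebesgue f - integral\<^sup>L lebesgue g"
proof -
  have "excess f g - excess g f = (LINT x|lebesgue. max (f x - g x) 0 - max (g x - f x) 0)"
    unfolding excess_def using assms by (intro Bochner_Integration.integral_diff[symmetric]) auto
  also have "\<dots> = (LINT x|lebesgue. f x - g x)"
    by (intro Bochner_Integration.integral_cong) auto
  finally show ?thesis using assms by simp
qed

lemma l1_dist_triangle:
  assumes "integrable lebesgue f" "integrable lebesgue g" "integrable lebesgue h"
  shows "l1_dist f h \<le> l1_dist f g + l1_dist g h"
  using excess_triangle[of f g h] excess_triangle[of h g f] assms by (simp add: l1_dist_eq_excess)

lemma l1_dist_zero: "l1_dist f (\<lambda>_. 0) = l1_norm f"
  by (simp add: l1_dist_def)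

lemma l1_norm_le_add_dist:
  assumes "integrable lebesgue f" "integrable lebesgue g"
  shows "l1_norm f \<le> l1_norm g + l1_dist f g"
  using l1_dist_triangle[of f g "\<lambda>_. 0"] assms by (simp add: l1_dist_zero)

lemma l1_dist_le_add_norm:
  assumes "integrable lebesgue f" "integrable lebesgue g"
  shows "l1_dist f g \<le> l1_norm f + l1_norm g"
  using l1_dist_triangle[of f "\<lambda>_. 0" g] assms
  by (simp add: l1_dist_zero l1_dist_commute[of "\<lambda>_. 0" g])

lemma l1_dist_eq_0_iff:
  assumes "integrable lebesgue f" "integrable lebesgue g"
  shows "l1_dist f g = 0 \<longleftrightarrow> (AE x in lebesgue. f x = g x)"
  using assms integral_nonneg_eq_0_iff_AE[of lebesgue "\<lambda>x. \<bar>f x - g x\<bar>"]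
  by (simp add: l1_dist_def l1_norm_def)

text \<open>Riesz-Fischer: a subsequence is Cauchy almost everywhere, its pointwise limit is the
  candidate, and Fatou's lemma carries the Cauchy estimate over to it.\<close>

lemma L1_complete:
  assumes int: "\<And>n. integrable lebesgue (s n)"
    and cauchy: "\<And>e. 0 < e \<Longrightarrow> \<exists>N. \<forall>i\<ge>N. \<forall>j\<ge>N. l1_dist (s i) (s j) < e"
  shows "\<exists>g. integrable lebesgue g \<and> (\<lambda>n. l1_dist (s n) g) \<longlonglongrightarrow> 0"
proof -
  note [measurable] = borel_measurable_integrable[OF int]
  obtain r where r: "strict_mono r" "AE x in lebesgue. Cauchy (\<lambda>i. s (r i) x)"
    by (rule cauchy_L1_AE_cauchy_subseq[of lebesgue s])
      (use int cauchy in \<open>auto simp: l1_dist_def l1_norm_def\<close>)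
  \<comment> \<open>Where the subsequence diverges, \<open>lim\<close> is some fixed value; this
    happens only on a null set and does not spoil measurability.\<close>
  define g where "g x = lim (\<lambda>i. s (r i) x)" for x
  have [measurable]: "g \<in> borel_measurable lebesgue"
    unfolding g_def by (rule borel_measurable_lim_metric) measurable
  have lim: "AE x in lebesgue. (\<lambda>i. s (r i) x) \<longlonglongrightarrow> g x"
    using r(2) by eventually_elim (simp add: g_def Cauchy_convergent_iff convergent_LIMSEQ_iff)
  \<comment> \<open>Stated with the nonnegative integral because integrability of \<open>g\<close>
    is not yet known; it is deduced from the case \<open>e = 1\<close>.\<close>
  have bound: "\<exists>N. \<forall>n\<ge>N. (\<integral>\<^sup>+x. \<bar>s n x - g x\<bar> \<partial>lebesgue) \<le> ennreal e" if "0 < e" for e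
  proof -
    obtain N where N: "\<And>i j. N \<le> i \<Longrightarrow> N \<le> j \<Longrightarrow> l1_dist (s i) (s j) < e"
      using cauchy[OF \<open>0 < e\<close>] by blast
    have "(\<integral>\<^sup>+x. \<bar>s n x - g x\<bar> \<partial>lebesgue) \<le> ennreal e" if "N \<le> n" for n
    proof -
      have "(\<integral>\<^sup>+x. \<bar>s n x - g x\<bar> \<partial>lebesgue)
          = (\<integral>\<^sup>+x. liminf (\<lambda>i. ennreal \<bar>s n x - s (r i) x\<bar>) \<partial>lebesgue)"
      proof (rule nn_integral_cong_AE, use lim in eventually_elim)
        case (elim x)
        then have "(\<lambda>i. ennreal \<bar>s n x - s (r i) x\<bar>) \<longlonglongrightarrow> ennreal \<bar>s n x - g x\<bar>"
          by (intro tendsto_intros)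
        from lim_imp_Liminf[OF sequentially_bot this] show ?case
          by (rule sym)
      qed
      also have "\<dots> \<le> liminf (\<lambda>i. \<integral>\<^sup>+x. ennreal \<bar>s n x - s (r i) x\<bar> \<partial>lebesgue)"
        by (rule nn_integral_liminf) measurable
      also have "\<dots> \<le> ennreal e"
      proof (rule Liminf_le)
        show "\<forall>\<^sub>F i in sequentially. (\<integral>\<^sup>+x. ennreal \<bar>s n x - s (r i) x\<bar> \<partial>lebesgue) \<le> ennreal e"
          using eventually_ge_at_top[of N]
        proof eventually_elim
          case (elim i)
          then have "l1_dist (s n) (s (r i)) < e"
            using N \<open>N \<le> n\<close> seq_suble[OF r(1), of i] by (meson order_trans)
          moreover have "(\<integral>\<^sup>+x. ennreal \<bar>s n x - s (r i) x\<bar> \<partial>lebesgue)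
              = ennreal (l1_dist (s n) (s (r i)))"
            unfolding l1_dist_def l1_norm_def using int by (intro nn_integral_eq_integral) auto
          ultimately show ?case
            by (simp add: ennreal_leI)
        qed
      qed simp
      finally show ?thesis .
    qed
    then show ?thesis by blast
  qed
  obtain n where "(\<integral>\<^sup>+x. \<bar>s n x - g x\<bar> \<partial>lebesgue) \<le> ennreal 1"
    using bound[of 1] by auto
  then have "integrable lebesgue (\<lambda>x. s n x - g x)"
    by (intro integrableI_bounded) (auto simp: le_less_trans)
  from Bochner_Integration.integrable_diff[OF int[of n] this]
  have g: "integrable lebesgue g" by simp
  have "(\<lambda>n. l1_dist (s n) g) \<longlonglongrightarrow> 0"
  proof (rule LIMSEQ_I)
    fix e :: real assume "0 < e"
    \<comment> \<open>Halving \<open>e\<close> turns the non-strict estimate into a strict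
      one.\<close>
    then obtain N where N: "\<And>n. N \<le> n \<Longrightarrow> (\<integral>\<^sup>+x. \<bar>s n x - g x\<bar> \<partial>lebesgue) \<le> ennreal (e / 2)"
      using bound[of "e / 2"] by auto
    have "l1_dist (s n) g \<le> e / 2" if "N \<le> n" for n
    proof -
      have eq: "ennreal (l1_dist (s n) g) = (\<integral>\<^sup>+x. \<bar>s n x - g x\<bar> \<partial>lebesgue)"
        unfolding l1_dist_def l1_norm_def using int g
        by (intro nn_integral_eq_integral[symmetric]) auto
      then show ?thesis
        using N[OF that] \<open>0 < e\<close> unfolding eq[symmetric] by (subst (asm) ennreal_le_iff) auto
    qed
    then show "\<exists>N. \<forall>n\<ge>N. norm (l1_dist (s n) g - 0) < e"
      using \<open>0 < e\<close> by (intro exI[of _ N]) (force simp: l1_dist_nonneg)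
  qed
  then show ?thesis using g by blast
qed

section \<open>The metric axioms for \<open>dp_fun\<close>\<close>

lemma dp_fun_nonneg: "0 \<le> dp_fun p f g"
  by (simp add: dp_fun_eq lp_pair_nonneg excess_nonneg)

lemma dp_fun_commute: "dp_fun p f g = dp_fun p g f"
  by (simp add: dp_fun_eq lp_pair_commute)

text \<open>One half of the equivalence with the \<open>L\<^sup>1\<close> distance;
  \<open>l1_dist_le_dp_fun\<close> is the other half. The constants 1 and 2 do not depend on
  \<open>p\<close>.\<close>

lemma dp_fun_le_l1_dist:
  assumes "1 \<le> p" "integrable lebesgue f" "integrable lebesgue g"
  shows "dp_fun p f g \<le> l1_dist f g"
  using assms by (simp add: dp_fun_eq l1_dist_eq_excess lp_pair_le_sum excess_nonneg)

lemma l1_dist_le_dp_fun: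
  assumes "1 \<le> p" "integrable lebesgue f" "integrable lebesgue g"
  shows "l1_dist f g \<le> 2 * dp_fun p f g"
  using assms lp_pair_ge_max[of p "excess f g" "excess g f"]
  by (simp add: dp_fun_eq l1_dist_eq_excess excess_nonneg)

lemma dp_fun_eq_0_iff:
  assumes "1 \<le> p" "integrable lebesgue f" "integrable lebesgue g"
  shows "dp_fun p f g = 0 \<longleftrightarrow> (AE x in lebesgue. f x = g x)"
  using l1_dist_le_dp_fun[OF assms] dp_fun_le_l1_dist[OF assms] dp_fun_nonneg[of p f g]
    l1_dist_nonneg[of f g] l1_dist_eq_0_iff[OF assms(2,3)] by auto

lemma dp_fun_triangle:
  assumes "1 \<le> p" "integrable lebesgue f" "integrable lebesgue g" "integrable lebesgue h"
  shows "dp_fun p f h \<le> dp_fun p f g + dp_fun p g h"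
proof -
  have "dp_fun p f h \<le> lp_pair p (excess f g + excess g h) (excess g f + excess h g)"
    unfolding dp_fun_eq using assms excess_triangle[of f g h] excess_triangle[of h g f]
    by (intro lp_pair_mono) (auto simp: excess_nonneg)
  also have "\<dots> \<le> dp_fun p f g + dp_fun p g h"
    unfolding dp_fun_eq using assms by (intro lp_pair_add) (auto simp: excess_nonneg)
  finally show ?thesis .
qed

section \<open>The metric axioms for the normalised distance\<close>

text \<open>Twice the normalising integral of \<open>d\<^sub>N\<close>: pointwise,
  \<open>2 max(|a|, |b|, |a - b|) = |a| + |b| + |a - b|\<close>.\<close>
definition l1_perimeter :: "(real \<Rightarrow> real) \<Rightarrow> (real \<Rightarrow> real) \<Rightarrow> real"
  where "l1_perimeter f g = l1_norm f + l1_norm g + l1_dist f g"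

lemma dpN_fun_eq:
  assumes "integrable lebesgue f" "integrable lebesgue g"
  shows "dpN_fun p f g = 2 * dp_fun p f g / l1_perimeter f g"
proof -
  have "(LINT x|lebesgue. Max {\<bar>f x\<bar>, \<bar>g x\<bar>, \<bar>f x - g x\<bar>})
      = (LINT x|lebesgue. (\<bar>f x\<bar> + \<bar>g x\<bar> + \<bar>f x - g x\<bar>) / 2)"
    by (intro Bochner_Integration.integral_cong) (auto simp: max_def)
  also have "\<dots> = l1_perimeter f g / 2"
    using assms by (simp add: l1_perimeter_def l1_dist_def l1_norm_def)
  finally show ?thesis
    unfolding dpN_fun_def by (simp only: divide_divide_eq_right mult.commute)
qed

lemma l1_perimeter_nonneg: "0 \<le> l1_perimeter f g"
  by (simp add: l1_perimeter_def l1_norm_nonneg l1_dist_nonneg)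

text \<open>This bounds the quotient by 1/2 and shows that a vanishing denominator forces a
  vanishing numerator, so the convention 0/0 = 0 is harmless.\<close>

lemma dp_fun_le_perimeter:
  assumes "1 \<le> p" "integrable lebesgue f" "integrable lebesgue g"
  shows "2 * dp_fun p f g \<le> l1_perimeter f g"
  using dp_fun_le_l1_dist[OF assms] l1_dist_le_add_norm[OF assms(2,3)]
  by (simp add: l1_perimeter_def)

lemma dpN_fun_nonneg:
  assumes "integrable lebesgue f" "integrable lebesgue g"
  shows "0 \<le> dpN_fun p f g"
  using assms by (simp add: dpN_fun_eq dp_fun_nonneg l1_perimeter_nonneg)

lemma dpN_fun_commute:
  assumes "integrable lebesgue f" "integrable lebesgue g"
  shows "dpN_fun p f g = dpN_fun p g f"
  using assms
  by (simp add: dpN_fun_eq dp_fun_commute[of p f] l1_perimeter_def l1_dist_commute[of f] add_ac)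

lemma dpN_fun_eq_0_iff:
  assumes "1 \<le> p" "integrable lebesgue f" "integrable lebesgue g"
  shows "dpN_fun p f g = 0 \<longleftrightarrow> (AE x in lebesgue. f x = g x)"
proof -
  have "dpN_fun p f g = 0 \<longleftrightarrow> dp_fun p f g = 0"
    using dp_fun_le_perimeter[OF assms] dp_fun_nonneg[of p f g] assms by (auto simp: dpN_fun_eq)
  then show ?thesis
    using assms by (simp add: dp_fun_eq_0_iff)
qed

text \<open>The detour through \<open>g\<close> raises both coordinates of the pair of excesses by the same
  amount \<open>t\<close>, hence \<open>l1_dist f h\<close> by \<open>2t\<close> and the \<open>\<ell>\<^sup>p\<close> norm by at least \<open>t\<close>. As the quotient
  \<open>dp_fun p f h / l1_perimeter f h\<close> is at most \<open>1/2\<close>, this does not decrease it; the rest is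
  the usual argument for the Steinhaus transform.\<close>
lemma dpN_fun_triangle:
  assumes p: "1 \<le> p"
    and int: "integrable lebesgue f" "integrable lebesgue g" "integrable lebesgue h"
  shows "dpN_fun p f h \<le> dpN_fun p f g + dpN_fun p g h"
proof (cases "l1_perimeter f h = 0")
  case True
  then show ?thesis
    using int by (simp add: dpN_fun_eq[of f h] dpN_fun_nonneg)
next
  case False
  define t where "t = excess f g + excess g h - excess f h"
  \<comment> \<open>\<open>T\<close> is
    \<open>l1_norm f + l1_dist f g + l1_dist g h + l1_norm h\<close>, the length of the closed path
    from 0 through \<open>f\<close>, \<open>g\<close>, \<open>h\<close> back to 0. Shortcutting
    through 0 shows that it dominates the perimeters of both legs.\<close>
  define T where "T = l1_perimeter f h + 2 * t"
  have t: "0 \<le> t" "excess f g + excess g h = excess f h + t"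
      "excess g f + excess h g = excess h f + t"
    using excess_triangle[of f g h] excess_diff[of f g] excess_diff[of g h] excess_diff[of f h] int
    by (auto simp: t_def)
  have pos: "0 < l1_perimeter f h" "0 < T"
    using False t(1) l1_perimeter_nonneg[of f h] by (auto simp: T_def)
  have "l1_dist f g + l1_dist g h = l1_dist f h + 2 * t"
    using t int by (simp add: l1_dist_eq_excess)
  then have le_T: "l1_perimeter f g \<le> T" "l1_perimeter g h \<le> T"
    using l1_norm_le_add_dist[of g h] l1_norm_le_add_dist[of g f] int
    by (auto simp: l1_perimeter_def T_def l1_dist_commute[of g f])
  have "2 * dp_fun p f h * t \<le> l1_perimeter f h * t"
    using dp_fun_le_perimeter[of p f h] assms t(1) by (intro mult_right_mono) auto
  then have "dp_fun p f h / l1_perimeter f h \<le> (dp_fun p f h + t) / T"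
    using pos by (simp add: T_def field_simps)
  also have "\<dots> \<le> lp_pair p (excess f g + excess g h) (excess g f + excess h g) / T"
    unfolding t(2,3) dp_fun_eq using p t(1) pos
    by (intro divide_right_mono lp_pair_diagonal) (auto simp: excess_nonneg)
  also have "\<dots> \<le> (dp_fun p f g + dp_fun p g h) / T"
    unfolding dp_fun_eq using p pos
    by (intro divide_right_mono lp_pair_add) (auto simp: excess_nonneg)
  finally have "dp_fun p f h / l1_perimeter f h \<le> dp_fun p f g / T + dp_fun p g h / T"
    by (simp add: add_divide_distrib)
  moreover have "dp_fun p u v / T \<le> dp_fun p u v / l1_perimeter u v"
    if "integrable lebesgue u" "integrable lebesgue v" "l1_perimeter u v \<le> T" for u v
  proof (cases "l1_perimeter u v = 0")
    case True
    then have "dp_fun p u v = 0"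
      using dp_fun_le_perimeter[OF p that(1,2)] dp_fun_nonneg[of p u v] by simp
    then show ?thesis by simp
  next
    case False
    then show ?thesis
      using that(3) l1_perimeter_nonneg[of u v] pos dp_fun_nonneg[of p u v]
      by (intro divide_left_mono) auto
  qed
  ultimately have "dp_fun p f h / l1_perimeter f h
      \<le> dp_fun p f g / l1_perimeter f g + dp_fun p g h / l1_perimeter g h"
    using le_T int by (smt (verit))
  then show ?thesis
    using int by (simp add: dpN_fun_eq)
qed

text \<open>Smallness of the normalised distance is smallness of the \<open>L\<^sup>1\<close>
  distance relative to the norms: the perimeter is at most twice the sum of the norms. If the
  perimeter is 0, both sides vanish.\<close>

lemma l1_dist_le_of_dpN_fun_less:
  assumes "1 \<le> p" "integrable lebesgue f" "integrable lebesgue g" "dpN_fun p f g < e"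
  shows "l1_dist f g \<le> 2 * e * (l1_norm f + l1_norm g)"
proof (cases "l1_perimeter f g = 0")
  case True
  then show ?thesis
    using l1_norm_nonneg[of f] l1_norm_nonneg[of g] l1_dist_nonneg[of f g]
    by (simp add: l1_perimeter_def add_nonneg_eq_0_iff)
next
  case False
  have e: "0 < e"
    using assms dpN_fun_nonneg[of f g p] by simp
  have "2 * dp_fun p f g \<le> e * l1_perimeter f g"
    using assms False l1_perimeter_nonneg[of f g] by (simp add: dpN_fun_eq divide_simps)
  also have "\<dots> \<le> e * (2 * (l1_norm f + l1_norm g))"
    using l1_dist_le_add_norm[OF assms(2,3)] e
    by (intro mult_left_mono) (auto simp: l1_perimeter_def)
  finally show ?thesis
    using l1_dist_le_dp_fun[OF assms(1-3)] by (simp add: mult_ac)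
qed

section \<open>Completeness at the level of functions\<close>

lemma dp_fun_complete:
  assumes p: "1 \<le> p" and int: "\<And>n. integrable lebesgue (s n)"
    and cauchy: "\<And>e. 0 < e \<Longrightarrow> \<exists>N. \<forall>i\<ge>N. \<forall>j\<ge>N. dp_fun p (s i) (s j) < e"
  shows "\<exists>g. integrable lebesgue g \<and> (\<lambda>n. dp_fun p (s n) g) \<longlonglongrightarrow> 0"
proof -
  have "\<exists>N. \<forall>i\<ge>N. \<forall>j\<ge>N. l1_dist (s i) (s j) < e" if "0 < e" for e
  proof -
    obtain N where N: "\<And>i j. N \<le> i \<Longrightarrow> N \<le> j \<Longrightarrow> dp_fun p (s i) (s j) < e / 2"
      using cauchy[of "e / 2"] \<open>0 < e\<close> by (meson half_gt_zero)
    have "l1_dist (s i) (s j) < e" if "N \<le> i" "N \<le> j" for i j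
      using N[OF that] l1_dist_le_dp_fun[OF p int int, of i j] by simp
    then show ?thesis by blast
  qed
  from L1_complete[OF int this]
  obtain g where g: "integrable lebesgue g" "(\<lambda>n. l1_dist (s n) g) \<longlonglongrightarrow> 0"
    by blast
  have "(\<lambda>n. dp_fun p (s n) g) \<longlonglongrightarrow> 0"
    by (rule tendsto_sandwich[OF _ _ tendsto_const g(2)])
      (auto simp: dp_fun_nonneg dp_fun_le_l1_dist p int g(1))
  then show ?thesis using g by blast
qed

text \<open>Along a Cauchy sequence the norms are eventually comparable, so either they all vanish
  eventually, or they stay bounded and bounded away from 0 and \<open>d\<^sub>N\<close> is comparable to the
  \<open>L\<^sup>1\<close> distance.\<close>
lemma dpN_fun_complete:
  assumes p: "1 \<le> p" and int: "\<And>n. integrable lebesgue (s n)"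
    and cauchy: "\<And>e. 0 < e \<Longrightarrow> \<exists>N. \<forall>i\<ge>N. \<forall>j\<ge>N. dpN_fun p (s i) (s j) < e"
  shows "\<exists>g. integrable lebesgue g \<and> (\<lambda>n. dpN_fun p (s n) g) \<longlonglongrightarrow> 0"
proof -
  \<comment> \<open>With 1/4 the distance of two terms is at most half the sum of their norms;
    absorbing half of \<open>l1_norm (s i)\<close> on the left gives the factor 3 below.\<close>
  obtain K where K: "\<And>i j. K \<le> i \<Longrightarrow> K \<le> j \<Longrightarrow> dpN_fun p (s i) (s j) < 1 / 4"
    using cauchy[of "1 / 4"] by auto
  have comparable: "l1_norm (s i) \<le> 3 * l1_norm (s j)" if "K \<le> i" "K \<le> j" for i j
    using l1_dist_le_of_dpN_fun_less[OF p int int K[OF that]] l1_norm_le_add_dist[OF int int, of i j]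
    by simp
  define B where "B = l1_norm (s K)"
  show ?thesis
  proof (cases "B = 0")
    case True
    have "dpN_fun p (s n) (\<lambda>_. 0) = 0" if "K \<le> n" for n
    proof -
      have "l1_dist (s n) (\<lambda>_. 0) = 0"
        using comparable[of n K] that True l1_norm_nonneg[of "s n"] by (simp add: B_def l1_dist_zero)
      then show ?thesis
        using int by (simp add: dpN_fun_eq_0_iff p l1_dist_eq_0_iff)
    qed
    then have "(\<lambda>n. dpN_fun p (s n) (\<lambda>_. 0)) \<longlonglongrightarrow> 0"
      by (intro tendsto_eventually) (auto simp: eventually_sequentially)
    then show ?thesis
      by (intro exI[of _ "\<lambda>_. 0"]) simp
  next
    case False
    then have B: "0 < B"
      using l1_norm_nonneg[of "s K"] by (simp add: B_def)
    have norms: "l1_norm (s n) \<le> 3 * B" "B \<le> 3 * l1_norm (s n)" if "K \<le> n" for n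
      using comparable[of n K] comparable[of K n] that by (auto simp: B_def)
    have "\<exists>N. \<forall>i\<ge>N. \<forall>j\<ge>N. l1_dist (s i) (s j) < e" if "0 < e" for e
    proof -
      \<comment> \<open>Both norms are at most \<open>3 * B\<close>, so the distance is at most
        \<open>2 * e' * (6 * B)\<close>, which this choice makes equal to
        \<open>e / 2\<close>.\<close>
      define e' where "e' = e / (24 * B)"
      have e': "0 < e'" "12 * B * e' < e"
        using that B by (auto simp: e'_def)
      obtain N where N: "\<And>i j. N \<le> i \<Longrightarrow> N \<le> j \<Longrightarrow> dpN_fun p (s i) (s j) < e'"
        using cauchy[OF e'(1)] by auto
      have "l1_dist (s i) (s j) < e" if "max N K \<le> i" "max N K \<le> j" for i j
      proof -
        have "l1_dist (s i) (s j) \<le> 2 * e' * (l1_norm (s i) + l1_norm (s j))"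
          using l1_dist_le_of_dpN_fun_less[OF p int int N] that by simp
        also have "\<dots> \<le> 2 * e' * (6 * B)"
          using norms(1)[of i] norms(1)[of j] that e' by (intro mult_left_mono) auto
        also have "\<dots> < e"
          using e'(2) by (simp add: mult_ac)
        finally show ?thesis .
      qed
      then show ?thesis by blast
    qed
    from L1_complete[OF int this]
    obtain g where g: "integrable lebesgue g" "(\<lambda>n. l1_dist (s n) g) \<longlonglongrightarrow> 0"
      by blast
    \<comment> \<open>The perimeter contains \<open>l1_norm (s n)\<close>, which is at least
      \<open>B / 3\<close>; this gives the constant \<open>6 / B\<close>.\<close>
    have bound: "dpN_fun p (s n) g \<le> 6 / B * l1_dist (s n) g" if "K \<le> n" for n
    proof -
      have "B / 3 \<le> l1_perimeter (s n) g"
        using norms(2)[OF that] l1_norm_nonneg[of g] l1_dist_nonneg[of "s n" g]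
        by (simp add: l1_perimeter_def)
      then have "dpN_fun p (s n) g \<le> 2 * l1_dist (s n) g / (B / 3)"
        unfolding dpN_fun_eq[OF int g(1)] using B dp_fun_le_l1_dist[OF p int g(1), of n]
        by (intro frac_le) (auto simp: l1_dist_nonneg)
      then show ?thesis by simp
    qed
    have "(\<lambda>n. dpN_fun p (s n) g) \<longlonglongrightarrow> 0"
    proof (rule tendsto_sandwich[OF _ _ tendsto_const])
      show "(\<lambda>n. 6 / B * l1_dist (s n) g) \<longlonglongrightarrow> 0"
        by (rule tendsto_mult_right_zero[OF g(2)])
      show "\<forall>\<^sub>F n in sequentially. dpN_fun p (s n) g \<le> 6 / B * l1_dist (s n) g"
        using bound by (auto simp: eventually_sequentially)
    qed (simp add: dpN_fun_nonneg int g(1))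
    then show ?thesis using g by blast
  qed
qed

section \<open>Passage to almost-everywhere classes\<close>

lemma integrable_rep_L1: "integrable lebesgue (rep_L1 x)"
  using Quotient_rep_reflp[OF Quotient_L1] by (simp add: L1_eq_def)

lemma L1_eqI: "(AE t in lebesgue. rep_L1 x t = rep_L1 y t) \<Longrightarrow> x = y"
  using Quotient_rel_rep[OF Quotient_L1] by (simp add: L1_eq_def integrable_rep_L1)

lemma L1_eq_rep_abs: "integrable lebesgue f \<Longrightarrow> L1_eq (rep_L1 (abs_L1 f)) f"
  using Quotient_rep_abs[OF Quotient_L1] by (simp add: L1_eq_def)

text \<open>Transfers both results at once from functions to classes. Invariance under
  \<open>L1_eq\<close> is what handles the limit: the representative of \<open>abs_L1 g\<close>
  agrees with \<open>g\<close> only almost everywhere.\<close>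

lemma metric_L1_complete:
  fixes D :: "(real \<Rightarrow> real) \<Rightarrow> (real \<Rightarrow> real) \<Rightarrow> real"
  assumes d: "\<And>x y. d x y = D (rep_L1 x) (rep_L1 y)"
    and cong: "\<And>f g f' g'. L1_eq f f' \<Longrightarrow> L1_eq g g' \<Longrightarrow> D f g = D f' g'"
    and nonneg: "\<And>f g. integrable lebesgue f \<Longrightarrow> integrable lebesgue g \<Longrightarrow> 0 \<le> D f g"
    and commute: "\<And>f g. integrable lebesgue f \<Longrightarrow> integrable lebesgue g \<Longrightarrow> D f g = D g f"
    and zero: "\<And>f g. integrable lebesgue f \<Longrightarrow> integrable lebesgue g \<Longrightarrow>
      D f g = 0 \<longleftrightarrow> (AE x in lebesgue. f x = g x)"
    and triangle: "\<And>f g h. integrable lebesgue f \<Longrightarrow> integrable lebesgue g \<Longrightarrow>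
      integrable lebesgue h \<Longrightarrow> D f h \<le> D f g + D g h"
    and complete: "\<And>s. (\<And>n. integrable lebesgue (s n)) \<Longrightarrow>
      (\<And>e. 0 < e \<Longrightarrow> \<exists>N. \<forall>i\<ge>N. \<forall>j\<ge>N. D (s i) (s j) < e) \<Longrightarrow>
      \<exists>g. integrable lebesgue g \<and> (\<lambda>n. D (s n) g) \<longlonglongrightarrow> 0"
  shows "Metric_space (UNIV :: L1 set) d \<and> Metric_space.mcomplete (UNIV :: L1 set) d"
proof -
  interpret Metric_space UNIV d
  proof
    show "d x y = 0 \<longleftrightarrow> x = y" for x y
      using L1_eqI by (auto simp: d zero integrable_rep_L1)
  qed (simp_all add: d nonneg triangle commute integrable_rep_L1)
  have "\<exists>x. limitin mtopology \<sigma> x sequentially" if \<sigma>: "MCauchy \<sigma>" for \<sigma>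
  proof -
    have "\<exists>N. \<forall>i\<ge>N. \<forall>j\<ge>N. D (rep_L1 (\<sigma> i)) (rep_L1 (\<sigma> j)) < e" if "0 < e" for e
      using \<sigma> that by (simp add: MCauchy_def d)
    from complete[of "\<lambda>n. rep_L1 (\<sigma> n)", OF integrable_rep_L1 this]
    obtain g where g: "integrable lebesgue g" "(\<lambda>n. D (rep_L1 (\<sigma> n)) g) \<longlonglongrightarrow> 0"
      by blast
    have "d (\<sigma> n) (abs_L1 g) = D (rep_L1 (\<sigma> n)) g" for n
      unfolding d by (intro cong L1_eq_rep_abs g(1)) (simp add: L1_eq_def integrable_rep_L1)
    then have "limitin mtopology \<sigma> (abs_L1 g) sequentially"
      using g(2) by (simp add: limitin_metric_dist_null)
    then show ?thesis by blast
  qed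
  then show ?thesis
    using Metric_space_axioms by (auto simp: mcomplete_def)
qed

theorem theorem3p7:
  fixes p :: ereal
  assumes "1 \<le> p"
  shows "Metric_space (UNIV :: L1 set) (dp p) \<and> Metric_space.mcomplete (UNIV :: L1 set) (dp p)
       \<and> Metric_space (UNIV :: L1 set) (dpN p) \<and> Metric_space.mcomplete (UNIV :: L1 set) (dpN p)"
proof -
  have "Metric_space UNIV (dp p) \<and> Metric_space.mcomplete UNIV (dp p)"
    by (rule metric_L1_complete[where D = "dp_fun p"])
      (auto simp: dp.rep_eq dp_fun_nonneg dp_fun_eq_0_iff assms
        intro: dp_fun_cong dp_fun_commute dp_fun_triangle dp_fun_complete)
  moreover have "Metric_space UNIV (dpN p) \<and> Metric_space.mcomplete UNIV (dpN p)"
    by (rule metric_L1_complete[where D = "dpN_fun p"])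
      (auto simp: dpN.rep_eq dpN_fun_nonneg dpN_fun_eq_0_iff assms
        intro: dpN_fun_cong dpN_fun_commute dpN_fun_triangle dpN_fun_complete)
  ultimately show ?thesis by blast
qed

end
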